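(* Retracts of diagonal metric spaces are diagonal: if $X$ is a diagonal metric space, $Y\subseteq X$ is a subspace, and there is a retraction of $X$ onto $Y$, then $Y$ is diagonal.
   Context: Metric spaces have a finite, symmetric, non-degenerate distance satisfying the triangle inequality; subspaces carry the restricted distance. A retraction of $X$ onto a subspace $Y$ is a $1$-Lipschitz map $f:X\to Y$ (i.e. $d(fx,fx')\le d(x,x')$) with $f|_Y=\mathrm{Id}_Y$. A point $z$ is between $x$ and $y$ if $d(x,y)=d(x,z)+d(z,y)$, strictly between if moreover $z\neq x,y$; $]x,y[$ is the set of points strictly between $x$ and $y$. A $k$-path ($k\ge0$) in $X$ is a sequence $\langle x_0,\dots,x_k\rangle$ of points of $X$ with $x_i\ne x_{i+1}$ for $0\le i<k$; it is saturated if each $]x_i,x_{i+1}[$ is empty. Magnitude complex: $\mathrm{MC}_k(X)$ is the free abelian group on the $k$-paths of $X$, with boundary $\partial_k=\sum_{i=1}^{k-1}(-1)^i\partial_{k,i}$, where $\partial_{k,i}\langle x_0,\dots,x_k\rangle=\langle x_0,\dots,\widehat{x_i},\dots,x_k\rangle$ if $x_i$ is between $x_{i-1}$ and $x_{i+1}$, and $0$ otherwise. $\mathrm{MH}_*(X)$ is its homology. A metric space $X$ is diagonal if for every $k$, $\mathrm{MH}_k(X)$ is generated by classes of cycles that are integral linear combinations of saturated $k$-paths of $X$. *)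

theory Defs
  imports "HOL-Analysis.Abstract_Metric_Spaces" "HOL-Algebra.Free_Abelian_Groups"
begin

text \<open>A metric space is a carrier \<open>M\<close> with a distance \<open>d\<close> such that \<open>Metric_space M d\<close>; a subspace
  is a subset of the carrier with the same \<open>d\<close>.\<close>

definition retraction_of :: "'a set \<Rightarrow> ('a \<Rightarrow> 'a \<Rightarrow> real) \<Rightarrow> 'a set \<Rightarrow> ('a \<Rightarrow> 'a) \<Rightarrow> bool" where
  "retraction_of M d N f \<longleftrightarrow>
     N \<subseteq> M \<and> f \<in> M \<rightarrow> N \<and>
     (\<forall>x\<in>M. \<forall>y\<in>M. d (f x) (f y) \<le> d x y) \<and>
     (\<forall>y\<in>N. f y = y)"

definition is_between :: "('a \<Rightarrow> 'a \<Rightarrow> real) \<Rightarrow> 'a \<Rightarrow> 'a \<Rightarrow> 'a \<Rightarrow> bool" where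
  "is_between d x z y \<longleftrightarrow> d x y = d x z + d z y"

definition open_interval :: "'a set \<Rightarrow> ('a \<Rightarrow> 'a \<Rightarrow> real) \<Rightarrow> 'a \<Rightarrow> 'a \<Rightarrow> 'a set" where
  "open_interval M d x y = {z \<in> M. is_between d x z y \<and> z \<noteq> x \<and> z \<noteq> y}"

definition kpaths :: "'a set \<Rightarrow> nat \<Rightarrow> 'a list set" where
  "kpaths M k = {xs. length xs = k + 1 \<and> set xs \<subseteq> M \<and> (\<forall>i<k. xs ! i \<noteq> xs ! (i + 1))}"

definition saturated_kpaths :: "'a set \<Rightarrow> ('a \<Rightarrow> 'a \<Rightarrow> real) \<Rightarrow> nat \<Rightarrow> 'a list set" where
  "saturated_kpaths M d k =
     {xs \<in> kpaths M k. \<forall>i<k. open_interval M d (xs ! i) (xs ! (i + 1)) = {}}"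

abbreviation MC :: "'a set \<Rightarrow> nat \<Rightarrow> ('a list \<Rightarrow>\<^sub>0 int) monoid" where
  "MC M k \<equiv> free_Abelian_group (kpaths M k)"

definition face :: "('a \<Rightarrow> 'a \<Rightarrow> real) \<Rightarrow> nat \<Rightarrow> 'a list \<Rightarrow> ('a list \<Rightarrow>\<^sub>0 int)" where
  "face d i xs =
     (if is_between d (xs ! (i - 1)) (xs ! i) (xs ! (i + 1))
      then frag_of (take i xs @ drop (i + 1) xs) else 0)"

text \<open>The sum is empty, hence the boundary zero, in degrees 0 and 1.\<close>

definition mag_boundary :: "('a \<Rightarrow> 'a \<Rightarrow> real) \<Rightarrow> nat \<Rightarrow> ('a list \<Rightarrow>\<^sub>0 int) \<Rightarrow> ('a list \<Rightarrow>\<^sub>0 int)" where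
  "mag_boundary d k = frag_extend (\<lambda>xs. \<Sum>i\<in>{1..<k}. frag_cmul ((-1) ^ i) (face d i xs))"

definition mag_cycles :: "'a set \<Rightarrow> ('a \<Rightarrow> 'a \<Rightarrow> real) \<Rightarrow> nat \<Rightarrow> ('a list \<Rightarrow>\<^sub>0 int) set" where
  "mag_cycles M d k = {c \<in> carrier (MC M k). mag_boundary d k c = 0}"

definition mag_boundaries :: "'a set \<Rightarrow> ('a \<Rightarrow> 'a \<Rightarrow> real) \<Rightarrow> nat \<Rightarrow> ('a list \<Rightarrow>\<^sub>0 int) set" where
  "mag_boundaries M d k = mag_boundary d (k + 1) ` carrier (MC M (k + 1))"

definition cycle_group :: "'a set \<Rightarrow> ('a \<Rightarrow> 'a \<Rightarrow> real) \<Rightarrow> nat \<Rightarrow> ('a list \<Rightarrow>\<^sub>0 int) monoid" where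
  "cycle_group M d k = (MC M k)\<lparr>carrier := mag_cycles M d k\<rparr>"

definition MH :: "'a set \<Rightarrow> ('a \<Rightarrow> 'a \<Rightarrow> real) \<Rightarrow> nat \<Rightarrow> ('a list \<Rightarrow>\<^sub>0 int) set monoid" where
  "MH M d k = cycle_group M d k Mod mag_boundaries M d k"

definition homology_class ::
  "'a set \<Rightarrow> ('a \<Rightarrow> 'a \<Rightarrow> real) \<Rightarrow> nat \<Rightarrow> ('a list \<Rightarrow>\<^sub>0 int) \<Rightarrow> ('a list \<Rightarrow>\<^sub>0 int) set" where
  "homology_class M d k c = mag_boundaries M d k #>\<^bsub>cycle_group M d k\<^esub> c"

definition diagonal_metric_space :: "'a set \<Rightarrow> ('a \<Rightarrow> 'a \<Rightarrow> real) \<Rightarrow> bool" where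
  "diagonal_metric_space M d \<longleftrightarrow>
     Metric_space M d \<and>
     (\<forall>k. carrier (MH M d k) =
        generate (MH M d k)
          (homology_class M d k `
            {c \<in> mag_cycles M d k. Poly_Mapping.keys c \<subseteq> saturated_kpaths M d k}))"

end

theory Submission
  imports Defs
begin

text \<open>
  Let \<open>f\<close> retract the diagonal space \<open>X\<close> onto \<open>Y\<close>, and let \<open>c\<close> be a cycle of \<open>Y\<close>.  Read as a cycle
  of \<open>X\<close>, it can be written \<open>c = s + \<partial> b\<close>, where \<open>s\<close> is a cycle made of paths saturated in \<open>X\<close>.
  Applying \<open>f\<close> to this equation is not enough: a 1-Lipschitz map can send a saturated path of \<open>X\<close> to
  a path that is not saturated in \<open>Y\<close>, so the image of \<open>s\<close> is of no direct use.  The way out is that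
  \<open>s\<close> lies in \<open>Y\<close> already.

  Indeed, a path occurring in a boundary has lost a point lying strictly between two of its
  consecutive points, hence is never saturated (\<open>boundary_has_no_saturated_path\<close>).  So \<open>s\<close> is
  the part of \<open>c\<close> carried by the paths that are saturated in \<open>X\<close>, and all paths of \<open>s\<close> occur in \<open>c\<close>
  (\<open>homologous_saturated_chain_is_part\<close>).  Those paths run in \<open>Y\<close> and are a fortiori saturated there,
  since \<open>Y\<close> has fewer intermediate points than \<open>X\<close>.

  The retraction then serves only to see that \<open>c - s\<close> bounds in \<open>Y\<close>: a 1-Lipschitz map induces a
  chain map (\<open>mag_boundary_pushforward\<close>), and the one induced by \<open>f\<close> fixes the chains of \<open>Y\<close>
  and carries \<open>b\<close> into \<open>Y\<close>, so that \<open>c - s = \<partial> (f b)\<close>.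

  Passing between chains and the group generated by homology classes requires that homology be a
  group, hence that \<open>\<partial> \<partial> = 0\<close>; \<open>diagonal_metric_space_iff\<close> makes the translation.
\<close>

section \<open>Deleting a point of a path\<close>

lemma nth_delete:
  assumes "i < length xs" "Suc m < length xs"
  shows "(take i xs @ drop (Suc i) xs) ! m = (if m < i then xs ! m else xs ! Suc m)"
  using assms by (auto simp: nth_append min_def)

lemma delete_delete:
  assumes "j < i" "i < length xs"
  shows "take j (take i xs @ drop (Suc i) xs) @ drop (Suc j) (take i xs @ drop (Suc i) xs)
       = take (i - 1) (take j xs @ drop (Suc j) xs) @ drop i (take j xs @ drop (Suc j) xs)"
    (is "?l = ?r")
proof (rule nth_equalityI)
  show "length ?l = length ?r" using assms by auto
next
  fix m assume m: "m < length ?l"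
  have l: "?l ! m = (if m < j then (take i xs @ drop (Suc i) xs) ! m
                      else (take i xs @ drop (Suc i) xs) ! Suc m)"
    using assms m by (intro nth_delete) auto
  have r: "?r ! m = (if m < i - 1 then (take j xs @ drop (Suc j) xs) ! m
                      else (take j xs @ drop (Suc j) xs) ! Suc m)"
    using assms m nth_delete [of "i - 1" "take j xs @ drop (Suc j) xs" m] by auto
  show "?l ! m = ?r ! m"
    unfolding l r using assms m by (auto simp: nth_delete)
qed

lemma kpaths_nth_in: "xs \<in> kpaths M k \<Longrightarrow> i \<le> k \<Longrightarrow> xs ! i \<in> M"
  unfolding kpaths_def by (auto simp: subset_iff)

lemma kpaths_mono: "M \<subseteq> N \<Longrightarrow> kpaths M k \<subseteq> kpaths N k"
  by (auto simp: kpaths_def)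

text \<open>Deleting an intermediate point leaves a path because \<open>d x z = d x y + d y z > 0\<close>; it is
  the betweenness condition in the definition of a face that excludes the repetition \<open>x, y, x\<close>.\<close>

lemma delete_between_in_kpaths:
  assumes "Metric_space M d" and xs: "xs \<in> kpaths M (Suc k)" and i: "0 < i" "i < Suc k"
    and btw: "is_between d (xs ! (i - 1)) (xs ! i) (xs ! (i + 1))"
  shows "take i xs @ drop (i + 1) xs \<in> kpaths M k"
proof -
  interpret Metric_space M d by fact
  have len: "length xs = k + 2" and M: "set xs \<subseteq> M"
    and ne: "\<And>j. j \<le> k \<Longrightarrow> xs ! j \<noteq> xs ! Suc j"
    using xs by (auto simp: kpaths_def)
  have "xs ! (i - 1) \<in> M" "xs ! i \<in> M" "xs ! Suc i \<in> M"
    using xs i by (auto intro: kpaths_nth_in)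
  moreover have "xs ! (i - 1) \<noteq> xs ! i"
    using ne [of "i - 1"] i by simp
  ultimately have "d (xs ! (i - 1)) (xs ! Suc i) > 0"
    using btw nonneg [of "xs ! i" "xs ! Suc i"] mdist_pos_less [of "xs ! (i - 1)" "xs ! i"]
    unfolding is_between_def Suc_eq_plus1 by linarith
  then have end_ne: "xs ! (i - 1) \<noteq> xs ! Suc i"
    using mdist_zero [OF \<open>xs ! Suc i \<in> M\<close>] by auto
  have "set (take i xs @ drop (i + 1) xs) \<subseteq> M"
    using M set_take_subset [of i xs] set_drop_subset [of "i+1" xs] by auto
  moreover have "(take i xs @ drop (i + 1) xs) ! j \<noteq> (take i xs @ drop (i + 1) xs) ! (j + 1)"
    if "j < k" for j
  proof -
    consider "Suc j < i" | "Suc j = i" | "i \<le> j" by linarith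
    then show ?thesis
    proof cases
      case 2
      then have "j = i - 1" by simp
      with 2 show ?thesis
        using end_ne that i len by (auto simp: nth_delete)
    qed (use that i len ne [of j] ne [of "Suc j"] in \<open>auto simp: nth_delete\<close>)
  qed
  ultimately show ?thesis
    using len i by (auto simp: kpaths_def)
qed

section \<open>The boundary\<close>

lemma mag_boundary_frag_of:
  "mag_boundary d k (frag_of xs) = (\<Sum>i\<in>{1..<k}. frag_cmul ((-1) ^ i) (face d i xs))"
  by (simp add: mag_boundary_def)

lemma mag_boundary_0 [simp]: "mag_boundary d k 0 = 0"
  and mag_boundary_diff: "mag_boundary d k (a - b) = mag_boundary d k a - mag_boundary d k b"
  and mag_boundary_cmul: "mag_boundary d k (frag_cmul m a) = frag_cmul m (mag_boundary d k a)"
  and mag_boundary_sum: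
    "finite I \<Longrightarrow> mag_boundary d k (sum g I) = (\<Sum>i\<in>I. mag_boundary d k (g i))"
  by (simp_all add: mag_boundary_def frag_extend_diff frag_extend_cmul frag_extend_sum)

lemma keys_mag_boundaryD:
  assumes "ys \<in> Poly_Mapping.keys (mag_boundary d k c)"
  obtains xs i where "xs \<in> Poly_Mapping.keys c" "0 < i" "i < k"
    "is_between d (xs ! (i - 1)) (xs ! i) (xs ! (i + 1))" "ys = take i xs @ drop (i + 1) xs"
proof -
  obtain xs where xs: "xs \<in> Poly_Mapping.keys c"
    and "ys \<in> Poly_Mapping.keys (\<Sum>i\<in>{1..<k}. frag_cmul ((-1) ^ i) (face d i xs))"
    using assms keys_frag_extend unfolding mag_boundary_def by fastforce
  then obtain i where "i \<in> {1..<k}" "ys \<in> Poly_Mapping.keys (face d i xs)"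
    using keys_sum [of _ "{1..<k}"] by fastforce
  with xs show ?thesis
    by (intro that [of xs i]) (auto simp: face_def split: if_splits)
qed

lemma mag_boundary_in_MC:
  assumes "Metric_space M d" "c \<in> carrier (MC M (Suc k))"
  shows "mag_boundary d (Suc k) c \<in> carrier (MC M k)"
proof -
  have "ys \<in> kpaths M k" if "ys \<in> Poly_Mapping.keys (mag_boundary d (Suc k) c)" for ys
    using that
  proof (rule keys_mag_boundaryD)
    fix xs i
    assume *: "xs \<in> Poly_Mapping.keys c" "0 < i" "i < Suc k"
      "is_between d (xs ! (i - 1)) (xs ! i) (xs ! (i + 1))" "ys = take i xs @ drop (i + 1) xs"
    then have "xs \<in> kpaths M (Suc k)" using assms(2) by auto
    then show "ys \<in> kpaths M k"
      using delete_between_in_kpaths [OF assms(1)] * by blast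
  qed
  then show ?thesis by auto
qed

text \<open>The deleted point is a witness for non-saturation: it is between its two neighbours, which
  become consecutive, and differs from both of them because the original list is a path.\<close>

lemma boundary_has_no_saturated_path:
  assumes "c \<in> carrier (MC M (Suc k))" "ys \<in> saturated_kpaths M d k"
  shows "ys \<notin> Poly_Mapping.keys (mag_boundary d (Suc k) c)"
proof
  assume "ys \<in> Poly_Mapping.keys (mag_boundary d (Suc k) c)"
  then show False
  proof (rule keys_mag_boundaryD)
    fix xs i
    assume *: "xs \<in> Poly_Mapping.keys c" "0 < i" "i < Suc k"
      and btw: "is_between d (xs ! (i - 1)) (xs ! i) (xs ! (i + 1))"
      and ys: "ys = take i xs @ drop (i + 1) xs"
    have xs: "xs \<in> kpaths M (Suc k)" using assms(1) * by auto
    have len: "length xs = k + 2" and ne: "\<And>j. j \<le> k \<Longrightarrow> xs ! j \<noteq> xs ! Suc j"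
      using xs by (auto simp: kpaths_def)
    have "ys ! (i - 1) = xs ! (i - 1)" "ys ! i = xs ! Suc i"
      unfolding ys using * len by (auto simp: nth_delete)
    moreover have "xs ! i \<in> open_interval M d (xs ! (i - 1)) (xs ! Suc i)"
      using xs btw * ne [of i] ne [of "i - 1"] by (force simp: open_interval_def kpaths_nth_in)
    moreover have "open_interval M d (ys ! (i - 1)) (ys ! i) = {}"
      using assms(2) * unfolding saturated_kpaths_def by (auto dest!: spec [of _ "i - 1"])
    ultimately show False by auto
  qed
qed

section \<open>The boundary squares to zero\<close>

text \<open>The simplicial identity.  For two points that are not adjacent the two betweenness conditions
  do not interact.  For adjacent ones, \<open>x, y, z, w\<close> with \<open>y\<close> and \<open>z\<close> deleted, either order asks for
  two conditions that together say \<open>d x w = d x y + d y z + d z w\<close>, by the triangle inequality.\<close>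

lemma face_face:
  assumes "Metric_space M d" and xs: "xs \<in> kpaths M k" and ji: "0 < j" "j < i" "i < k"
  shows "frag_extend (face d j) (face d i xs) = frag_extend (face d (i - 1)) (face d j xs)"
proof -
  interpret Metric_space M d by fact
  have len: "length xs = k + 1" using xs by (auto simp: kpaths_def)
  let ?di = "take i xs @ drop (i + 1) xs" and ?dj = "take j xs @ drop (j + 1) xs"
  have "is_between d (xs ! (i - 1)) (xs ! i) (xs ! (i + 1)) \<and>
          is_between d (?di ! (j - 1)) (?di ! j) (?di ! (j + 1))
     \<longleftrightarrow> is_between d (xs ! (j - 1)) (xs ! j) (xs ! (j + 1)) \<and>
          is_between d (?dj ! (i - 1 - 1)) (?dj ! (i - 1)) (?dj ! (i - 1 + 1))"
  proof (cases "Suc j = i")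
    case True
    obtain l where l: "j = Suc l" using ji gr0_conv_Suc by auto
    have "xs ! l \<in> M" "xs ! Suc l \<in> M" "xs ! Suc (Suc l) \<in> M" "xs ! Suc (Suc (Suc l)) \<in> M"
      using xs ji True l by (auto intro: kpaths_nth_in)
    then show ?thesis
      using ji len True l
        triangle [of "xs ! l" "xs ! Suc l" "xs ! Suc (Suc l)"]
        triangle [of "xs ! Suc l" "xs ! Suc (Suc l)" "xs ! Suc (Suc (Suc l))"]
        triangle [of "xs ! l" "xs ! Suc l" "xs ! Suc (Suc (Suc l))"]
        triangle [of "xs ! l" "xs ! Suc (Suc l)" "xs ! Suc (Suc (Suc l))"]
      by (auto simp: nth_delete is_between_def)
  next
    case False
    define l where "l = i - 2"
    have "i = Suc (Suc l)" "j \<le> l"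
      using ji False by (simp_all add: l_def)
    then show ?thesis
      using ji len by (auto simp: nth_delete)
  qed
  moreover have "take j ?di @ drop (j + 1) ?di = take (i - 1) ?dj @ drop (i - 1 + 1) ?dj"
    using delete_delete [of j i xs] ji len by simp
  ultimately show ?thesis
    by (auto simp: face_def)
qed

text \<open>The usual sign cancellation: the face identity matches the term \<open>(i, j)\<close> with \<open>j < i\<close> against the
  term \<open>(j, i - 1)\<close> of opposite sign.\<close>

lemma mag_boundary_boundary_path:
  assumes "Metric_space M d" and xs: "xs \<in> kpaths M (Suc k)"
  shows "mag_boundary d k (mag_boundary d (Suc k) (frag_of xs)) = 0"
proof -
  define t where "t i j = frag_cmul ((-1) ^ (i + j)) (frag_extend (face d j) (face d i xs))" for i j
  have bd: "mag_boundary d k (face d i xs)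
      = (\<Sum>j\<in>{1..<k}. frag_cmul ((-1) ^ j) (frag_extend (face d j) (face d i xs)))" for i
    by (simp add: face_def mag_boundary_def)
  have "mag_boundary d k (mag_boundary d (Suc k) (frag_of xs))
      = (\<Sum>i\<in>{1..<Suc k}. \<Sum>j\<in>{1..<k}. t i j)"
    unfolding mag_boundary_frag_of
    by (simp add: mag_boundary_sum mag_boundary_cmul bd frag_cmul_sum t_def power_add o_def
        del: sum.op_ivl_Suc)
  also have "\<dots> = (\<Sum>(i, j) \<in> {1..<Suc k} \<times> {1..<k}. t i j)"
    by (simp add: sum.cartesian_product)
  also have "\<dots> = (\<Sum>(i, j) \<in> {(i, j). 1 \<le> j \<and> j < i \<and> i \<le> k}. t i j)
                + (\<Sum>(i, j) \<in> {(i, j). 1 \<le> i \<and> i \<le> j \<and> j < k}. t i j)"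
  proof (subst sum.union_disjoint [symmetric])
    show "finite {(i, j). 1 \<le> j \<and> j < i \<and> i \<le> k}"
      by (rule finite_subset [of _ "{..k} \<times> {..k}"]) auto
    show "finite {(i, j). 1 \<le> i \<and> i \<le> j \<and> j < k}"
      by (rule finite_subset [of _ "{..k} \<times> {..k}"]) auto
  qed (auto intro!: sum.cong)
  also have "(\<Sum>(i, j) \<in> {(i, j). 1 \<le> j \<and> j < i \<and> i \<le> k}. t i j)
           = (\<Sum>(i, j) \<in> {(i, j). 1 \<le> i \<and> i \<le> j \<and> j < k}. - t i j)"
  proof (rule sum.reindex_bij_witness
      [where i = "\<lambda>(i, j). (Suc j, i)" and j = "\<lambda>(i, j). (j, i - 1)"])
    fix p assume "p \<in> {(i, j). 1 \<le> j \<and> j < i \<and> i \<le> k}"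
    then obtain i j where p: "p = (i, j)" "1 \<le> j" "j < i" "i \<le> k" by auto
    then obtain l where l: "i = Suc l" by (cases i) auto
    show "(case case p of (i, j) \<Rightarrow> (j, i - 1) of (i, j) \<Rightarrow> - t i j) = (case p of (i, j) \<Rightarrow> t i j)"
      using face_face [OF assms, of j i] p l by (simp add: t_def add.commute)
  qed auto
  also have "\<dots> + (\<Sum>(i, j) \<in> {(i, j). 1 \<le> i \<and> i \<le> j \<and> j < k}. t i j) = 0"
    by (simp add: sum.distrib [symmetric] case_prod_unfold)
  finally show ?thesis .
qed

lemma mag_boundary_boundary:
  assumes "Metric_space M d" "c \<in> carrier (MC M (Suc k))"
  shows "mag_boundary d k (mag_boundary d (Suc k) c) = 0"
proof -
  have "Poly_Mapping.keys c \<subseteq> kpaths M (Suc k)" using assms(2) by simp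
  then show ?thesis
    by (induction c rule: frag_induction)
      (auto simp: mag_boundary_boundary_path [OF assms(1)] mag_boundary_diff)
qed

section \<open>Diagonality in terms of chains\<close>

lemma subgroup_MC:
  assumes "0 \<in> H" "\<And>a b. a \<in> H \<Longrightarrow> b \<in> H \<Longrightarrow> a - b \<in> H" "H \<subseteq> carrier (MC M k)"
  shows "subgroup H (MC M k)"
proof -
  interpret group "MC M k" by simp
  have minus: "- a \<in> H" if "a \<in> H" for a
    using assms(2) [OF assms(1) that] by simp
  have "a + b \<in> H" if "a \<in> H" "b \<in> H" for a b
    using assms(2) [OF that(1) minus [OF that(2)]] by simp
  moreover have "inv\<^bsub>MC M k\<^esub> a = - a" if "a \<in> H" for a
    using subsetD [OF assms(3) that] by simp
  ultimately show ?thesis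
    using assms minus by (intro subgroupI) auto
qed

lemma keys_diff_subset:
  fixes a b :: "'a \<Rightarrow>\<^sub>0 int"
  assumes "Poly_Mapping.keys a \<subseteq> S" "Poly_Mapping.keys b \<subseteq> S"
  shows "Poly_Mapping.keys (a - b) \<subseteq> S"
  using keys_diff [of a b] assms by blast

lemma mag_cycles_diff:
  "a \<in> mag_cycles M d k \<Longrightarrow> b \<in> mag_cycles M d k \<Longrightarrow> a - b \<in> mag_cycles M d k"
  by (simp add: mag_cycles_def mag_boundary_diff keys_diff_subset)

lemma mag_boundaries_subset_cycles:
  "Metric_space M d \<Longrightarrow> mag_boundaries M d k \<subseteq> mag_cycles M d k"
  unfolding mag_boundaries_def mag_cycles_def Suc_eq_plus1 [symmetric]
  using mag_boundary_in_MC [of M d] mag_boundary_boundary [of M d] by blast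

lemma zero_in_mag_boundaries: "0 \<in> mag_boundaries M d k"
  unfolding mag_boundaries_def by (rule image_eqI [of _ _ 0]) auto

lemma mag_boundaries_diff:
  assumes "a \<in> mag_boundaries M d k" "b \<in> mag_boundaries M d k"
  shows "a - b \<in> mag_boundaries M d k"
proof -
  obtain a' b' where "a' \<in> carrier (MC M (k + 1))" "b' \<in> carrier (MC M (k + 1))"
    "a = mag_boundary d (k + 1) a'" "b = mag_boundary d (k + 1) b'"
    using assms by (auto simp: mag_boundaries_def)
  then show ?thesis
    unfolding mag_boundaries_def
    by (intro image_eqI [of _ _ "a' - b'"]) (simp_all add: mag_boundary_diff keys_diff_subset)
qed

text \<open>Cycles carried by saturated paths form a subgroup, so their classes do as well, and this image
  is all that they generate.  Diagonality therefore says that each single cycle is homologous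
  to a cycle of saturated paths.\<close>

theorem diagonal_metric_space_iff:
  assumes "Metric_space M d"
  shows "diagonal_metric_space M d \<longleftrightarrow>
    (\<forall>k. \<forall>c\<in>mag_cycles M d k. \<exists>s\<in>mag_cycles M d k.
       Poly_Mapping.keys s \<subseteq> saturated_kpaths M d k \<and> c - s \<in> mag_boundaries M d k)"
proof -
  have "carrier (MH M d k) = generate (MH M d k)
          (homology_class M d k ` {c \<in> mag_cycles M d k. Poly_Mapping.keys c \<subseteq> saturated_kpaths M d k})
    \<longleftrightarrow> (\<forall>c\<in>mag_cycles M d k. \<exists>s\<in>mag_cycles M d k.
       Poly_Mapping.keys s \<subseteq> saturated_kpaths M d k \<and> c - s \<in> mag_boundaries M d k)" for k
  proof -
    let ?Z = "mag_cycles M d k" and ?B = "mag_boundaries M d k" and ?h = "homology_class M d k"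
    let ?S = "{c \<in> ?Z. Poly_Mapping.keys c \<subseteq> saturated_kpaths M d k}"
    interpret MC: comm_group "MC M k" by (rule abelian_free_Abelian_group)
    have Z: "subgroup ?Z (MC M k)"
      by (rule subgroup_MC) (simp_all add: mag_cycles_diff, auto simp: mag_cycles_def)
    have B: "subgroup ?B (MC M k)"
      by (rule subgroup_MC)
        (use mag_boundaries_subset_cycles [OF assms] subgroup.subset [OF Z]
          in \<open>blast intro: zero_in_mag_boundaries mag_boundaries_diff\<close>)+
    have S: "subgroup ?S (MC M k)"
      by (rule subgroup_MC)
        (simp_all add: mag_cycles_diff keys_diff_subset, auto simp: mag_cycles_def)
    let ?G = "cycle_group M d k"
    interpret G: comm_group ?G
      unfolding cycle_group_def
      by (rule group.group_comm_groupI [OF MC.subgroup_imp_group [OF Z]]) (simp add: add.commute)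
    have carG [simp]: "carrier ?G = ?Z" and multG [simp]: "\<And>a b. a \<otimes>\<^bsub>?G\<^esub> b = a + b"
      by (simp_all add: cycle_group_def)
    have SG: "subgroup ?S ?G" and BG: "subgroup ?B ?G"
      unfolding cycle_group_def
      using MC.subgroup_incl [OF S Z] MC.subgroup_incl [OF B Z] mag_boundaries_subset_cycles [OF assms]
      by auto
    interpret N: normal ?B ?G
      by (rule G.subgroup_imp_normal [OF BG])
    interpret H: group "MH M d k"
      unfolding MH_def by (rule N.factorgroup_is_group)
    interpret h: group_hom ?G "MH M d k" ?h
      using N.r_coset_hom_Mod
      by unfold_locales (simp add: MH_def homology_class_def [abs_def])
    have gen: "generate (MH M d k) (?h ` ?S) = ?h ` ?S"
      using H.generateI [OF h.subgroup_img_is_subgroup [OF SG]] by blast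
    have car: "carrier (MH M d k) = ?h ` ?Z"
      by (simp add: MH_def carrier_FactGroup homology_class_def)
    have eq: "?h c = ?h s \<longleftrightarrow> c - s \<in> ?B" if "c \<in> ?Z" "s \<in> ?Z" for c s
    proof
      assume "?h c = ?h s"
      moreover have "c \<in> ?h c"
        using zero_in_mag_boundaries [of M d k] by (force simp: homology_class_def r_coset_def)
      ultimately show "c - s \<in> ?B"
        by (auto simp: homology_class_def r_coset_def)
    next
      assume "c - s \<in> ?B"
      then have "c \<in> ?h s"
        by (auto simp: homology_class_def r_coset_def intro!: bexI [of _ "c - s"])
      then show "?h c = ?h s"
        unfolding homology_class_def using that G.repr_independence [OF _ _ BG] by simp
    qed
    have "?h ` ?Z = ?h ` ?S \<longleftrightarrow> (\<forall>c\<in>?Z. \<exists>s\<in>?S. ?h c = ?h s)"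
      by blast
    also have "\<dots> \<longleftrightarrow> (\<forall>c\<in>?Z. \<exists>s\<in>?S. c - s \<in> ?B)"
      by (intro ball_cong bex_cong refl eq) auto
    also have "\<dots> \<longleftrightarrow> (\<forall>c\<in>?Z. \<exists>s\<in>?Z. Poly_Mapping.keys s \<subseteq> saturated_kpaths M d k \<and> c - s \<in> ?B)"
      by blast
    finally show ?thesis
      unfolding gen car .
  qed
  then show ?thesis
    using assms by (simp add: diagonal_metric_space_def)
qed

section \<open>Functoriality under 1-Lipschitz maps\<close>

definition preserves_steps :: "('a \<Rightarrow> 'a \<Rightarrow> real) \<Rightarrow> ('b \<Rightarrow> 'b \<Rightarrow> real) \<Rightarrow> ('a \<Rightarrow> 'b) \<Rightarrow> 'a list \<Rightarrow> bool"
  where "preserves_steps d e f xs \<longleftrightarrow>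
    (\<forall>i. Suc i < length xs \<longrightarrow> e (f (xs ! i)) (f (xs ! Suc i)) = d (xs ! i) (xs ! Suc i))"

text \<open>The chain map induced by a map: paths with a shortened step are sent to zero, since the
  magnitude complex is graded by the length of paths.\<close>

definition pushforward ::
  "('a \<Rightarrow> 'a \<Rightarrow> real) \<Rightarrow> ('b \<Rightarrow> 'b \<Rightarrow> real) \<Rightarrow> ('a \<Rightarrow> 'b) \<Rightarrow> ('a list \<Rightarrow>\<^sub>0 int) \<Rightarrow> ('b list \<Rightarrow>\<^sub>0 int)"
  where "pushforward d e f =
    frag_extend (\<lambda>xs. if preserves_steps d e f xs then frag_of (map f xs) else 0)"

lemma pushforward_frag_of:
  "pushforward d e f (frag_of xs) = (if preserves_steps d e f xs then frag_of (map f xs) else 0)"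
  by (simp add: pushforward_def)

lemma pushforward_0 [simp]: "pushforward d e f 0 = 0"
  and pushforward_diff: "pushforward d e f (a - b) = pushforward d e f a - pushforward d e f b"
  and pushforward_cmul: "pushforward d e f (frag_cmul m a) = frag_cmul m (pushforward d e f a)"
  and pushforward_sum:
    "finite I \<Longrightarrow> pushforward d e f (sum g I) = (\<Sum>i\<in>I. pushforward d e f (g i))"
  by (simp_all add: pushforward_def frag_extend_diff frag_extend_cmul frag_extend_sum)

lemma pushforward_in_MC:
  assumes "Metric_space X d" "Metric_space Y e" "f \<in> X \<rightarrow> Y" "c \<in> carrier (MC X k)"
  shows "pushforward d e f c \<in> carrier (MC Y k)"
proof -
  interpret X: Metric_space X d by fact
  interpret Y: Metric_space Y e by fact
  have "map f xs \<in> kpaths Y k" if xs: "xs \<in> kpaths X k" and p: "preserves_steps d e f xs" for xs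
  proof -
    have len: "length xs = k + 1" and X: "set xs \<subseteq> X" using xs by (auto simp: kpaths_def)
    have "f (xs ! i) \<noteq> f (xs ! Suc i)" if "i < k" for i
    proof -
      have "xs ! i \<in> X" "xs ! Suc i \<in> X" "xs ! i \<noteq> xs ! Suc i"
        using that xs by (auto simp: kpaths_nth_in) (auto simp: kpaths_def)
      then have "d (xs ! i) (xs ! Suc i) > 0" by simp
      then have "e (f (xs ! i)) (f (xs ! Suc i)) > 0"
        using p that len by (simp add: preserves_steps_def)
      then show ?thesis
        using Y.mdist_zero [of "f (xs ! i)"] assms(3) \<open>xs ! i \<in> X\<close> by fastforce
    qed
    then show ?thesis
      using len X assms(3) by (auto simp: kpaths_def)
  qed
  then have "Poly_Mapping.keys (if preserves_steps d e f xs then frag_of (map f xs) else 0)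
      \<subseteq> kpaths Y k" if "xs \<in> Poly_Mapping.keys c" for xs
    using that assms(4) by auto
  then show ?thesis
    unfolding pushforward_def carrier_free_Abelian_group_iff
    using keys_frag_extend by fastforce
qed

text \<open>Let \<open>x, y, z\<close> be the points around the deleted position.  Under a 1-Lipschitz map \<open>f\<close>,
  \<open>e (f x) (f z) \<le> e (f x) (f y) + e (f y) (f z) \<le> d x y + d y z\<close>.  When \<open>y\<close> is between \<open>x\<close> and \<open>z\<close>, the right-hand
  side is \<open>d x z\<close>, so the merged step keeps its length exactly when both steps do and \<open>f y\<close> is
  between \<open>f x\<close> and \<open>f z\<close>.  When both steps keep their length and \<open>f y\<close> is between, then \<open>d x y + d y z\<close> is
  \<open>e (f x) (f z) \<le> d x z\<close>, so \<open>y\<close> is between as well.  Hence both sides vanish under the same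
  conditions.\<close>

lemma pushforward_face:
  assumes "Metric_space X d" "Metric_space Y e" and f: "f \<in> X \<rightarrow> Y"
    and lip: "\<And>x y. x \<in> X \<Longrightarrow> y \<in> X \<Longrightarrow> e (f x) (f y) \<le> d x y"
    and xs: "xs \<in> kpaths X k" and i: "0 < i" "i < k"
  shows "frag_extend (face e i) (pushforward d e f (frag_of xs)) = pushforward d e f (face d i xs)"
proof -
  interpret X: Metric_space X d by fact
  interpret Y: Metric_space Y e by fact
  have len: "length xs = k + 1" using xs by (auto simp: kpaths_def)
  obtain l where l: "i = Suc l" using i gr0_conv_Suc by auto
  define x y z where "x = xs ! l" and "y = xs ! Suc l" and "z = xs ! Suc (Suc l)"
  let ?ys = "take i xs @ drop (i + 1) xs"
  let ?fb = "is_between e (f x) (f y) (f z)" and ?b = "is_between d x y z"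
  have X: "x \<in> X" "y \<in> X" "z \<in> X"
    using xs i l by (auto simp: x_def y_def z_def kpaths_nth_in)
  then have Y: "f x \<in> Y" "f y \<in> Y" "f z \<in> Y" using f by auto
  note tri = X.triangle [OF X] Y.triangle [OF Y] lip [OF X(1,2)] lip [OF X(2,3)] lip [OF X(1,3)]
  have at_i: "e (f x) (f y) = d x y" "e (f y) (f z) = d y z" if "preserves_steps d e f xs"
    using that i l len by (auto simp: preserves_steps_def x_def y_def z_def)
  have 1: "?b" if "preserves_steps d e f xs" ?fb
    using at_i that tri by (auto simp: is_between_def)
  have 2: "preserves_steps d e f ?ys \<longleftrightarrow> preserves_steps d e f xs \<and> ?fb" if b: ?b
  proof
    assume p: "preserves_steps d e f ?ys"
    have step: "e (f (?ys ! m)) (f (?ys ! Suc m)) = d (?ys ! m) (?ys ! Suc m)" if "Suc m < k" for m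
      using p that len i by (auto simp: preserves_steps_def)
    have "e (f x) (f z) = d x z"
      using step [of l] i l len by (simp add: nth_delete x_def z_def)
    then have xy: "e (f x) (f y) = d x y" and yz: "e (f y) (f z) = d y z" and ?fb
      using b tri by (auto simp: is_between_def)
    moreover have "e (f (xs ! m)) (f (xs ! Suc m)) = d (xs ! m) (xs ! Suc m)" if "m < k" for m
    proof -
      consider "m < l" | "m = l" | "m = Suc l" | "Suc l < m" by linarith
      then show ?thesis
      proof cases
        case 1
        then show ?thesis using step [of m] i l len by (simp add: nth_delete)
      next
        case 4
        then obtain n where "m = Suc n" "l < n" by (cases m) auto
        then show ?thesis using step [of n] that i l len by (simp add: nth_delete)
      qed (use xy yz in \<open>auto simp: x_def y_def z_def\<close>)
    qed
    ultimately show "preserves_steps d e f xs \<and> ?fb"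
      using len by (auto simp: preserves_steps_def)
  next
    assume p: "preserves_steps d e f xs \<and> ?fb"
    then have xz: "e (f x) (f z) = d x z"
      using at_i b by (auto simp: is_between_def)
    have step: "e (f (xs ! m)) (f (xs ! Suc m)) = d (xs ! m) (xs ! Suc m)" if "m < k" for m
      using p that len by (auto simp: preserves_steps_def)
    have "e (f (?ys ! m)) (f (?ys ! Suc m)) = d (?ys ! m) (?ys ! Suc m)" if "Suc m < k" for m
    proof -
      consider "m < l" | "m = l" | "l < m" by linarith
      then show ?thesis
      proof cases
        case 2
        then show ?thesis using xz that i l len by (simp add: nth_delete x_def z_def)
      qed (use step [of m] step [of "Suc m"] that i l len in \<open>auto simp: nth_delete\<close>)
    qed
    then show "preserves_steps d e f ?ys"
      using len i by (auto simp: preserves_steps_def)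
  qed
  have face_e: "face e i (map f xs) = (if ?fb then frag_of (map f ?ys) else 0)"
    using i l len by (simp add: face_def x_def y_def z_def take_map drop_map)
  have face_d: "face d i xs = (if ?b then frag_of ?ys else 0)"
    using i l len by (simp add: face_def x_def y_def z_def)
  show ?thesis
    unfolding face_d using 1 2 face_e by (auto simp: pushforward_frag_of)
qed

lemma mag_boundary_pushforward:
  assumes "Metric_space X d" "Metric_space Y e" "f \<in> X \<rightarrow> Y"
    and "\<And>x y. x \<in> X \<Longrightarrow> y \<in> X \<Longrightarrow> e (f x) (f y) \<le> d x y"
    and "c \<in> carrier (MC X k)"
  shows "mag_boundary e k (pushforward d e f c) = pushforward d e f (mag_boundary d k c)"
proof -
  have "Poly_Mapping.keys c \<subseteq> kpaths X k" using assms(5) by simp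
  then show ?thesis
  proof (induction c rule: frag_induction)
    case (one xs)
    have "mag_boundary e k (pushforward d e f (frag_of xs)) =
        (\<Sum>i\<in>{1..<k}. frag_cmul ((-1) ^ i) (frag_extend (face e i) (pushforward d e f (frag_of xs))))"
      by (simp add: pushforward_frag_of mag_boundary_frag_of)
    also have "\<dots> = (\<Sum>i\<in>{1..<k}. frag_cmul ((-1) ^ i) (pushforward d e f (face d i xs)))"
      using one by (intro sum.cong refl arg_cong [where f = "frag_cmul _"] pushforward_face [OF assms(1-4)]) auto
    also have "\<dots> = pushforward d e f (mag_boundary d k (frag_of xs))"
      by (simp add: mag_boundary_frag_of pushforward_sum pushforward_cmul)
    finally show ?case .
  qed (auto simp: pushforward_diff mag_boundary_diff)
qed

lemma pushforward_fixed:
  assumes "c \<in> carrier (MC Y k)" "\<And>y. y \<in> Y \<Longrightarrow> f y = y"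
  shows "pushforward d d f c = c"
proof -
  have "(if preserves_steps d d f xs then frag_of (map f xs) else 0) = frag_of xs"
    if "xs \<in> Poly_Mapping.keys c" for xs
  proof -
    have "set xs \<subseteq> Y" using that assms(1) by (auto simp: kpaths_def)
    then have "map f xs = xs" "preserves_steps d d f xs"
      using assms(2) by (auto simp: preserves_steps_def map_idI subset_iff)
    then show ?thesis by simp
  qed
  then show ?thesis
    unfolding pushforward_def by (subst (2) frag_expansion) (rule frag_extend_eq)
qed

section \<open>Retracts\<close>

text \<open>At a saturated path the boundary \<open>c - s\<close> has coefficient zero, so \<open>c\<close> and \<open>s\<close> agree there.  This
  is what forces a saturated representative in the ambient space back into the subspace.\<close>

lemma homologous_saturated_chain_is_part:
  assumes "c - s \<in> mag_boundaries M d k" "Poly_Mapping.keys s \<subseteq> saturated_kpaths M d k"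
  shows "Poly_Mapping.keys s \<subseteq> Poly_Mapping.keys c"
proof
  fix xs assume xs: "xs \<in> Poly_Mapping.keys s"
  then have "xs \<notin> Poly_Mapping.keys (c - s)"
    using assms boundary_has_no_saturated_path [of _ M k xs d] by (auto simp: mag_boundaries_def)
  then have "Poly_Mapping.lookup c xs = Poly_Mapping.lookup s xs"
    by (simp add: in_keys_iff lookup_minus)
  with xs show "xs \<in> Poly_Mapping.keys c"
    by (simp add: in_keys_iff)
qed

text \<open>The chain map of the retraction fixes \<open>c\<close> and moves any chain with boundary \<open>c\<close> into the subspace.\<close>

lemma retraction_reflects_boundaries:
  assumes X: "Metric_space X d" and f: "retraction_of X d Y f"
    and c: "c \<in> carrier (MC Y k)" "c \<in> mag_boundaries X d k"
  shows "c \<in> mag_boundaries Y d k"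
proof -
  have YX: "Y \<subseteq> X" and fXY: "f \<in> X \<rightarrow> Y" and lip: "\<And>x y. x \<in> X \<Longrightarrow> y \<in> X \<Longrightarrow> d (f x) (f y) \<le> d x y"
    and fix_Y: "\<And>y. y \<in> Y \<Longrightarrow> f y = y"
    using f by (auto simp: retraction_of_def)
  have Y: "Metric_space Y d"
    using X YX by (rule Metric_space.subspace)
  obtain b where b: "b \<in> carrier (MC X (k + 1))" "c = mag_boundary d (k + 1) b"
    using c(2) by (auto simp: mag_boundaries_def)
  have "c = pushforward d d f (mag_boundary d (k + 1) b)"
    using pushforward_fixed [OF c(1), of f d] fix_Y b(2) by simp
  also have "\<dots> = mag_boundary d (k + 1) (pushforward d d f b)"
    using mag_boundary_pushforward [OF X Y fXY lip b(1)] by simp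
  finally show ?thesis
    using pushforward_in_MC [OF X Y fXY b(1)] unfolding mag_boundaries_def by blast
qed

theorem proposition4p12:
  fixes X Y :: "'a set" and d :: "'a \<Rightarrow> 'a \<Rightarrow> real"
  assumes "diagonal_metric_space X d"
    and "Y \<subseteq> X"
    and "\<exists>f. retraction_of X d Y f"
  shows "diagonal_metric_space Y d"
proof -
  obtain f where f: "retraction_of X d Y f" using assms(3) by blast
  have X: "Metric_space X d" using assms(1) by (simp add: diagonal_metric_space_def)
  then have Y: "Metric_space Y d" using assms(2) by (rule Metric_space.subspace)
  have "\<exists>s\<in>mag_cycles Y d k. Poly_Mapping.keys s \<subseteq> saturated_kpaths Y d k
          \<and> c - s \<in> mag_boundaries Y d k" if c: "c \<in> mag_cycles Y d k" for c k
  proof -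
    have cY: "Poly_Mapping.keys c \<subseteq> kpaths Y k" using c by (simp add: mag_cycles_def)
    have "c \<in> mag_cycles X d k"
      using c kpaths_mono [OF assms(2), of k] by (auto simp: mag_cycles_def)
    then obtain s where s: "s \<in> mag_cycles X d k"
      "Poly_Mapping.keys s \<subseteq> saturated_kpaths X d k" "c - s \<in> mag_boundaries X d k"
      using assms(1) diagonal_metric_space_iff [OF X] by blast
    have sY: "Poly_Mapping.keys s \<subseteq> kpaths Y k"
      using homologous_saturated_chain_is_part [OF s(3,2)] cY by blast
    have "kpaths Y k \<inter> saturated_kpaths X d k \<subseteq> saturated_kpaths Y d k"
      using assms(2) by (fastforce simp: saturated_kpaths_def open_interval_def)
    then have "Poly_Mapping.keys s \<subseteq> saturated_kpaths Y d k"
      using sY s(2) by blast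
    moreover have "s \<in> mag_cycles Y d k"
      using s(1) sY by (simp add: mag_cycles_def)
    moreover have "c - s \<in> mag_boundaries Y d k"
      using keys_diff_subset [OF cY sY] s(3)
      by (intro retraction_reflects_boundaries [OF X f]) simp_all
    ultimately show ?thesis by blast
  qed
  then show ?thesis
    using diagonal_metric_space_iff [OF Y] by blast
qed

end
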